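(* Let $D$ be an integral domain with quotient field $K$, and let $\mathrm{Loc}(D):=\{D_P\mid P\in\mathrm{Spec}(D)\}$, endowed with the subspace topology induced by the Zariski topology of $\mathrm{Over}(D)$. Then: (a) $\mathrm{Loc}(D)$ is a spectral space. (b) $\mathrm{Loc}(D)$ is proconstructible in $\mathrm{Over}(D)$ if and only if $D$ is rad-colon coherent.
   Context: "Compact" does not include Hausdorff. A spectral space is a topological space homeomorphic to the prime spectrum of a commutative unitary ring with the Zariski topology. If $X$ is a spectral space, the constructible topology on $X$ is the coarsest topology in which all open and compact subsets of $X$ (in the original topology) are both open and closed; a subset $Y\subseteq X$ is proconstructible if it is closed in the constructible topology. An overring of $D$ is a ring $T$ with $D\subseteq T\subseteq K$; $\mathrm{Over}(D)$ is the set of all overrings of $D$, endowed with the Zariski topology, which has as a basis of open sets the sets $\mathcal{B}(x_1,\ldots,x_n):=\{T\in\mathrm{Over}(D)\mid x_1,\ldots,x_n\in T\}$, as $x_1,\ldots,x_n$ range in $K$. It is known that $\mathrm{Over}(D)$ is a spectral space. For $x\in K$, $(D:_Dx):=\{d\in D\mid dx\in D\}$. The domain $D$ is rad-colon coherent if, for every $x\in K\setminus D$, there is a finitely generated ideal $I$ of $D$ such that $\mathrm{rad}(I)=\mathrm{rad}((D:_Dx))$ (equivalently, $\{P\in\mathrm{Spec}(D)\mid (D:_Dx)\nsubseteq P\}$ is compact for every $x\in K$). *)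

theory Defs
  imports "HOL-Analysis.Abstract_Topology" "HOL-Algebra.Subrings" "HOL-Algebra.Ideal"
begin

definition Spec :: "('a, 'm) ring_scheme \<Rightarrow> 'a set set" where
  "Spec R = {P. primeideal P R}"

definition zariski_Spec :: "('a, 'm) ring_scheme \<Rightarrow> 'a set topology" where
  "zariski_Spec R = topology_generated_by {{P \<in> Spec R. f \<notin> P} | f. f \<in> carrier R}"

(* HOL cannot quantify existentially over types inside a formula, so the type on which the
   ring lives is a parameter.  For every choice of 'r, the predicate implies that X is
   homeomorphic to the prime spectrum of some commutative unitary ring. *)
definition spectral_space :: "'r itself \<Rightarrow> 'b topology \<Rightarrow> bool" where
  "spectral_space r X \<longleftrightarrow> (\<exists>R :: 'r ring. cring R \<and> X homeomorphic_space zariski_Spec R)"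

definition constructible_topology :: "'b topology \<Rightarrow> 'b topology" where
  "constructible_topology X =
     topology_generated_by
       ({U. openin X U \<and> compactin X U} \<union> {topspace X - U | U. openin X U \<and> compactin X U})"

definition proconstructible :: "'b topology \<Rightarrow> 'b set \<Rightarrow> bool" where
  "proconstructible X Y \<longleftrightarrow> closedin (constructible_topology X) Y"

text \<open>Subrings of a field \<open>K\<close> are represented by their carriers, and \<open>K\<lparr>carrier := D\<rparr>\<close> is
  the ring with carrier \<open>D\<close>.\<close>

definition quotient_field :: "'a set \<Rightarrow> ('a, 'm) ring_scheme \<Rightarrow> bool" where
  "quotient_field D K \<longleftrightarrow>
     field K \<and> subring D K \<and>
     (\<forall>x \<in> carrier K. \<exists>a \<in> D. \<exists>b \<in> D - {\<zero>\<^bsub>K\<^esub>}. x = a \<otimes>\<^bsub>K\<^esub> inv\<^bsub>K\<^esub> b)"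

definition Over :: "'a set \<Rightarrow> ('a, 'm) ring_scheme \<Rightarrow> 'a set set" where
  "Over D K = {T. subring T K \<and> D \<subseteq> T}"

definition zariski_Over :: "'a set \<Rightarrow> ('a, 'm) ring_scheme \<Rightarrow> 'a set topology" where
  "zariski_Over D K =
     topology_generated_by {{T \<in> Over D K. F \<subseteq> T} | F. finite F \<and> F \<subseteq> carrier K}"

definition localization_at :: "'a set \<Rightarrow> ('a, 'm) ring_scheme \<Rightarrow> 'a set \<Rightarrow> 'a set" where
  "localization_at D K P = {a \<otimes>\<^bsub>K\<^esub> inv\<^bsub>K\<^esub> s | a s. a \<in> D \<and> s \<in> D - P}"

definition Loc :: "'a set \<Rightarrow> ('a, 'm) ring_scheme \<Rightarrow> 'a set set" where
  "Loc D K = localization_at D K ` Spec (K\<lparr>carrier := D\<rparr>)"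

definition ideal_radical :: "('a, 'm) ring_scheme \<Rightarrow> 'a set \<Rightarrow> 'a set" where
  "ideal_radical R I = {d \<in> carrier R. \<exists>n::nat. n \<ge> 1 \<and> d [^]\<^bsub>R\<^esub> n \<in> I}"

definition fin_gen_ideal :: "'a set \<Rightarrow> ('a, 'm) ring_scheme \<Rightarrow> bool" where
  "fin_gen_ideal I R \<longleftrightarrow> (\<exists>S. finite S \<and> S \<subseteq> carrier R \<and> I = Idl\<^bsub>R\<^esub> S)"

definition colon :: "'a set \<Rightarrow> ('a, 'm) ring_scheme \<Rightarrow> 'a \<Rightarrow> 'a set" where
  "colon D K x = {d \<in> D. d \<otimes>\<^bsub>K\<^esub> x \<in> D}"

definition rad_colon_coherent :: "'a set \<Rightarrow> ('a, 'm) ring_scheme \<Rightarrow> bool" where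
  "rad_colon_coherent D K \<longleftrightarrow>
     (\<forall>x \<in> carrier K - D. \<exists>I. fin_gen_ideal I (K\<lparr>carrier := D\<rparr>) \<and>
        ideal_radical (K\<lparr>carrier := D\<rparr>) I = ideal_radical (K\<lparr>carrier := D\<rparr>) (colon D K x))"

end

theory Submission
  imports Defs "HOL-Analysis.Function_Topology" "HOL-Algebra.Ring_Divisibility"
    "HOL-Algebra.Generated_Rings"
begin

text \<open>
  Everything rests on one translation: an element \<open>x\<close> of \<open>K\<close> lies in \<open>D\<^sub>P\<close> iff the colon ideal
  \<open>(D : x)\<close> is not contained in \<open>P\<close>, and for nonzero \<open>d\<close> in \<open>D\<close> the inverse of \<open>d\<close> lies in \<open>D\<^sub>P\<close>
  iff \<open>d\<close> is not in \<open>P\<close> (\<open>localization_at_iff\<close>, \<open>inv_in_localization_at_iff\<close>).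

  (a) By the second equivalence \<open>P\<close> can be recovered from \<open>D\<^sub>P\<close> as the set of elements of \<open>D\<close> that are
  not invertible in \<open>D\<^sub>P\<close>. Both equivalences match subbasic open sets with open sets, so \<open>P \<mapsto> D\<^sub>P\<close> is a
  homeomorphism from the spectrum of \<open>D\<close> onto the space of localizations
  (\<open>Loc_homeomorphic_Spec\<close>).

  (b) Taking radicals is taking intersections of primes, so rad-colon coherence says that for each
  \<open>x\<close> outside \<open>D\<close> there is a finite subset \<open>S\<close> of \<open>D\<close> such that the same primes contain \<open>S\<close> and
  \<open>(D : x)\<close> (\<open>rad_colon_coherent_iff\<close>).

  If the localizations form a proconstructible set, then those containing \<open>x\<close> form a closed subset
  of the constructible topology on all overrings, which is compact (\<open>compact_space_Constr\<close>). Each of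
  them contains the inverse of a nonzero element \<open>f\<close> of \<open>(D : x)\<close>; these conditions are open, and
  the elements \<open>f\<close> of a finite subcover form the set \<open>S\<close>.

  Conversely, an overring \<open>T\<close> is a localization at a prime iff its nonunits in \<open>D\<close> are closed under
  addition and each element of \<open>T\<close> has a denominator in \<open>D\<close> that is invertible in \<open>T\<close>. The second
  condition, that some element of \<open>(D : x)\<close> be invertible in \<open>T\<close>, is an infinite disjunction; once
  \<open>(D : x)\<close> can be replaced by a finite set it becomes closed
  (\<open>Loc_eq_of_finite_denominators\<close>).
\<close>

section \<open>Generated topologies\<close>

text \<open>Alexander's theorem for a topology given by its generators. The library states it for the
  topology of unions of finite intersections; that one is finer, and compactness passes along the
  continuous identity map.\<close>

lemma compact_space_topology_generated_by:
  assumes "\<And>\<C>. \<lbrakk>\<C> \<subseteq> \<B>; \<Union>\<C> = \<Union>\<B>\<rbrakk> \<Longrightarrow> \<exists>\<F>. finite \<F> \<and> \<F> \<subseteq> \<C> \<and> \<Union>\<F> = \<Union>\<B>"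
  shows "compact_space (topology_generated_by \<B>)"
proof -
  define X where "X = topology (arbitrary union_of (finite intersection_of (\<lambda>x. x \<in> \<B>) relative_to \<Union>\<B>))"
  have top: "topspace X = \<Union>\<B>"
    unfolding X_def by (rule topspace_subbase)
  have compact: "compact_space X"
    by (rule Alexander_subbase[of \<B>]) (use assms top X_def in auto)
  have basic: "openin X U" if "U \<in> \<B>" for U
    unfolding X_def openin_subbase
    by (rule arbitrary_union_of_inc, rule relative_to_subset_inc)
       (use that in \<open>auto intro: finite_intersection_of_inc\<close>)
  have "continuous_map X (topology_generated_by \<B>) (\<lambda>x. x)"
  proof (rule continuous_on_generated_topo)
    fix U assume "U \<in> \<B>"
    moreover from this have "(\<lambda>x. x) -` U \<inter> topspace X = U"
      using top by auto
    ultimately show "openin X ((\<lambda>x. x) -` U \<inter> topspace X)"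
      using basic by simp
  qed (simp add: top)
  then have "compactin (topology_generated_by \<B>) ((\<lambda>x. x) ` topspace X)"
    using compact image_compactin unfolding compact_space_def by blast
  then show ?thesis
    by (simp add: compact_space_def top)
qed

lemma compact_space_coarser:
  assumes "compact_space X" "topspace Y = topspace X" "\<And>U. openin Y U \<Longrightarrow> openin X U"
  shows "compact_space Y"
  using assms unfolding compact_space_def compactin_def by metis

section \<open>Primes and radicals\<close>

text \<open>Closure under negation comes from multiplication by \<open>-1\<close>.\<close>

lemma (in cring) ideal_of_closed:
  assumes "I \<subseteq> carrier R" "\<zero> \<in> I"
    and add: "\<And>a b. \<lbrakk>a \<in> I; b \<in> I\<rbrakk> \<Longrightarrow> a \<oplus> b \<in> I"
    and mult: "\<And>a r. \<lbrakk>a \<in> I; r \<in> carrier R\<rbrakk> \<Longrightarrow> r \<otimes> a \<in> I"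
  shows "ideal I R"
proof (rule idealI[OF ring_axioms])
  show "subgroup I (add_monoid R)"
  proof (rule add.subgroupI)
    fix a assume a: "a \<in> I"
    then have "(\<ominus> \<one>) \<otimes> a \<in> I" using mult by simp
    then show "\<ominus> a \<in> I" using a assms(1) by (simp add: l_minus subset_iff)
  qed (use assms in auto)
next
  fix a r assume a: "a \<in> I" "r \<in> carrier R"
  then show "a \<otimes> r \<in> I"
    using mult m_comm[of a r] assms(1) by auto
qed (use mult in auto)

text \<open>Krull's argument: an ideal that is maximal among those containing \<open>I\<close> and avoiding all powers of
  \<open>f\<close> is prime. If \<open>a\<close> and \<open>b\<close> lie outside it, then some powers of \<open>f\<close> lie in the ideals generated
  by adding \<open>a\<close> or \<open>b\<close>, and their product would be a power of \<open>f\<close> in the maximal ideal as soon as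
  \<open>a \<otimes> b\<close> is.\<close>

lemma (in cring) exists_prime_avoiding_powers:
  assumes I: "ideal I R" and f: "f \<in> carrier R"
    and pow: "\<And>n::nat. n \<ge> 1 \<Longrightarrow> f [^] n \<notin> I"
  shows "\<exists>P. primeideal P R \<and> I \<subseteq> P \<and> f \<notin> P"
proof -
  define \<A> where "\<A> = {J. ideal J R \<and> I \<subseteq> J \<and> (\<forall>n::nat. n \<ge> 1 \<longrightarrow> f [^] n \<notin> J)}"
  have "I \<in> \<A>"
    using I pow by (auto simp: \<A>_def)
  have "\<exists>M\<in>\<A>. \<forall>J\<in>\<A>. M \<subseteq> J \<longrightarrow> J = M"
  proof (rule subset_Zorn_nonempty)
    show "\<A> \<noteq> {}" using \<open>I \<in> \<A>\<close> by blast
    fix \<C> assume \<C>: "\<C> \<noteq> {}" "subset.chain \<A> \<C>"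
    then have "subset.chain {J. ideal J R} \<C>"
      unfolding pred_on.chain_def \<A>_def by blast
    then have "ideal (\<Union>\<C>) R"
      using chain_Union_is_ideal[of \<C>] \<C>(1) by simp
    moreover have "\<C> \<subseteq> \<A>"
      using \<C>(2) unfolding pred_on.chain_def by blast
    ultimately show "\<Union>\<C> \<in> \<A>"
      using \<C>(1) unfolding \<A>_def by blast
  qed
  then obtain M where M: "M \<in> \<A>" and max: "\<And>J. \<lbrakk>J \<in> \<A>; M \<subseteq> J\<rbrakk> \<Longrightarrow> J = M"
    by blast
  interpret M: ideal M R
    using M by (simp add: \<A>_def)
  have fM: "f [^] n \<notin> M" if "n \<ge> 1" for n :: nat
    using M that by (simp add: \<A>_def)
  have power_in_extension: "\<exists>n\<ge>1. \<exists>m\<in>M. \<exists>r\<in>carrier R. f [^] (n::nat) = m \<oplus> r \<otimes> a"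
    if a: "a \<in> carrier R" "a \<notin> M" for a
  proof -
    have J: "ideal (M <+> PIdl a) R"
      by (rule add_ideals[OF M.is_ideal cgenideal_ideal[OF a(1)]])
    have mem: "y \<in> M <+> PIdl a \<longleftrightarrow> (\<exists>m\<in>M. \<exists>r\<in>carrier R. y = m \<oplus> r \<otimes> a)" for y
      unfolding set_add_def' cgenideal_def by auto
    have "M \<subseteq> M <+> PIdl a"
    proof
      fix m assume m: "m \<in> M"
      then have "m = m \<oplus> \<zero> \<otimes> a" using a by simp
      then show "m \<in> M <+> PIdl a" using mem m by blast
    qed
    moreover have "a \<in> M <+> PIdl a"
    proof -
      have "a = \<zero> \<oplus> \<one> \<otimes> a" using a by simp
      then show ?thesis using mem M.zero_closed by blast
    qed
    ultimately have "M <+> PIdl a \<notin> \<A>"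
      using max a(2) by blast
    with J \<open>M \<subseteq> M <+> PIdl a\<close> M obtain n :: nat where "n \<ge> 1" "f [^] n \<in> M <+> PIdl a"
      unfolding \<A>_def by blast
    then show ?thesis using mem by blast
  qed
  have "primeideal M R"
  proof (rule primeidealI[OF M.is_ideal is_cring])
    show "carrier R \<noteq> M" using fM[of 1] f by auto
    fix a b assume ab: "a \<in> carrier R" "b \<in> carrier R" "a \<otimes> b \<in> M"
    show "a \<in> M \<or> b \<in> M"
    proof (rule ccontr)
      assume "\<not> ?thesis"
      then obtain n k :: nat and m r m' s where
        n: "n \<ge> 1" "m \<in> M" "r \<in> carrier R" "f [^] n = m \<oplus> r \<otimes> a" and
        k: "k \<ge> 1" "m' \<in> M" "s \<in> carrier R" "f [^] k = m' \<oplus> s \<otimes> b"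
        using power_in_extension[of a] power_in_extension[of b] ab by blast
      have m: "m \<in> carrier R" "m' \<in> carrier R"
        using n k by auto
      have "f [^] (n + k) = (m \<oplus> r \<otimes> a) \<otimes> (m' \<oplus> s \<otimes> b)"
        using f n k by (simp flip: nat_pow_mult)
      also have "\<dots> = (m' \<oplus> s \<otimes> b) \<otimes> m \<oplus> ((r \<otimes> a) \<otimes> m' \<oplus> (r \<otimes> s) \<otimes> (a \<otimes> b))"
        using m n(3) k(3) ab by algebra
      also have "\<dots> \<in> M"
      proof -
        have "(m' \<oplus> s \<otimes> b) \<otimes> m \<in> M"
          using m n k ab by (intro M.I_l_closed) auto
        moreover have "(r \<otimes> a) \<otimes> m' \<in> M"
          using n k ab by (intro M.I_l_closed) auto
        moreover have "(r \<otimes> s) \<otimes> (a \<otimes> b) \<in> M"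
          using n k by (intro M.I_l_closed[OF ab(3)]) auto
        ultimately show ?thesis by (intro M.a_closed)
      qed
      finally show False using fM[of "n + k"] n by simp
    qed
  qed
  moreover have "I \<subseteq> M" "f \<notin> M"
    using M fM[of 1] f by (auto simp: \<A>_def)
  ultimately show ?thesis by blast
qed

lemma (in primeideal) pow_in_primeD:
  assumes "f \<in> carrier R" "f [^] (n::nat) \<in> I" "n \<ge> 1"
  shows "f \<in> I"
  using assms
proof (induction n)
  case (Suc n)
  then have "f [^] n \<in> I \<or> f \<in> I"
    using I_prime[of "f [^] n" f] by simp
  then show ?case
    using Suc by (cases n) auto
qed simp

lemma (in cring) ideal_radical_eq:
  assumes "ideal I R"
  shows "ideal_radical R I = {f \<in> carrier R. \<forall>P\<in>Spec R. I \<subseteq> P \<longrightarrow> f \<in> P}"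
proof (intro Set.set_eqI iffI)
  fix f assume "f \<in> ideal_radical R I"
  then obtain n :: nat where n: "f \<in> carrier R" "n \<ge> 1" "f [^] n \<in> I"
    unfolding ideal_radical_def by blast
  then have "f \<in> P" if "P \<in> Spec R" "I \<subseteq> P" for P
    using that primeideal.pow_in_primeD[of P R f n] by (auto simp: Spec_def)
  then show "f \<in> {f \<in> carrier R. \<forall>P\<in>Spec R. I \<subseteq> P \<longrightarrow> f \<in> P}"
    using n(1) by blast
next
  fix f assume f: "f \<in> {f \<in> carrier R. \<forall>P\<in>Spec R. I \<subseteq> P \<longrightarrow> f \<in> P}"
  then have "\<nexists>P. primeideal P R \<and> I \<subseteq> P \<and> f \<notin> P"
    by (auto simp: Spec_def)
  then obtain n :: nat where "n \<ge> 1" "f [^] n \<in> I"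
    using exists_prime_avoiding_powers[OF assms, of f] f by blast
  then show "f \<in> ideal_radical R I"
    using f unfolding ideal_radical_def by blast
qed

lemma (in cring) ideal_radical_eq_iff:
  assumes I: "ideal I R" and J: "ideal J R"
  shows "ideal_radical R I = ideal_radical R J \<longleftrightarrow> (\<forall>P\<in>Spec R. I \<subseteq> P \<longleftrightarrow> J \<subseteq> P)"
proof
  have sub: "L \<subseteq> P \<longleftrightarrow> ideal_radical R L \<subseteq> P" if L: "ideal L R" and P: "P \<in> Spec R" for L P
  proof
    have "L \<subseteq> carrier R" using L by (meson ideal.Icarr subsetI)
    then show "ideal_radical R L \<subseteq> P \<Longrightarrow> L \<subseteq> P"
      unfolding ideal_radical_eq[OF L] by blast
    show "L \<subseteq> P \<Longrightarrow> ideal_radical R L \<subseteq> P"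
      unfolding ideal_radical_eq[OF L] using P by blast
  qed
  show "\<forall>P\<in>Spec R. I \<subseteq> P \<longleftrightarrow> J \<subseteq> P" if "ideal_radical R I = ideal_radical R J"
    using sub[OF I] sub[OF J] that by blast
  show "ideal_radical R I = ideal_radical R J" if "\<forall>P\<in>Spec R. I \<subseteq> P \<longleftrightarrow> J \<subseteq> P"
    unfolding ideal_radical_eq[OF I] ideal_radical_eq[OF J] using that by blast
qed

section \<open>Localizations inside the field\<close>

locale subring_of_field = field K for K (structure) +
  fixes D
  assumes D_subring: "subring D K"
begin

abbreviation R where "R \<equiv> K\<lparr>carrier := D\<rparr>"

lemmas D_closed = subringE[OF D_subring]

lemma D_carrier [simp]: "d \<in> D \<Longrightarrow> d \<in> carrier K"
  using D_closed(1) by blast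

lemma cring_R: "cring R"
  using subring_is_domain[OF D_subring] by (rule domain.axioms)

lemma inv_in_carrier [simp]: "\<lbrakk>x \<in> carrier K; x \<noteq> \<zero>\<rbrakk> \<Longrightarrow> inv x \<in> carrier K"
  using field_Units by auto

lemma inv_cancel [simp]:
  "\<lbrakk>x \<in> carrier K; x \<noteq> \<zero>\<rbrakk> \<Longrightarrow> x \<otimes> inv x = \<one>" "\<lbrakk>x \<in> carrier K; x \<noteq> \<zero>\<rbrakk> \<Longrightarrow> inv x \<otimes> x = \<one>"
  using field_Units by auto

lemma SpecD:
  assumes "P \<in> Spec R"
  shows "P \<subseteq> D" "\<zero> \<in> P" "\<one> \<notin> P"
    and "\<And>a b. \<lbrakk>a \<in> P; b \<in> P\<rbrakk> \<Longrightarrow> a \<oplus> b \<in> P"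
    and "\<And>a r. \<lbrakk>a \<in> P; r \<in> D\<rbrakk> \<Longrightarrow> r \<otimes> a \<in> P"
    and "\<And>a b. \<lbrakk>a \<in> D; b \<in> D; a \<otimes> b \<in> P\<rbrakk> \<Longrightarrow> a \<in> P \<or> b \<in> P"
proof -
  interpret P: primeideal P R
    using assms by (simp add: Spec_def)
  show "P \<subseteq> D"
    using P.a_subset by simp
  show "\<zero> \<in> P"
    using additive_subgroup.zero_closed[OF P.is_additive_subgroup] by simp
  show "\<one> \<notin> P"
    using P.one_imp_carrier P.I_notcarr by auto
  show "\<And>a b. \<lbrakk>a \<in> P; b \<in> P\<rbrakk> \<Longrightarrow> a \<oplus> b \<in> P"
    using additive_subgroup.a_closed[OF P.is_additive_subgroup] by simp
  show "\<And>a r. \<lbrakk>a \<in> P; r \<in> D\<rbrakk> \<Longrightarrow> r \<otimes> a \<in> P"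
    using P.I_l_closed by simp
  show "\<And>a b. \<lbrakk>a \<in> D; b \<in> D; a \<otimes> b \<in> P\<rbrakk> \<Longrightarrow> a \<in> P \<or> b \<in> P"
    using P.I_prime by simp
qed

lemma colon_ideal:
  assumes "x \<in> carrier K"
  shows "ideal (colon D K x) R"
proof (rule cring.ideal_of_closed[OF cring_R])
  show "colon D K x \<subseteq> carrier R" "\<zero>\<^bsub>R\<^esub> \<in> colon D K x"
    using assms D_closed(2) by (auto simp: colon_def)
  show "a \<oplus>\<^bsub>R\<^esub> b \<in> colon D K x" if "a \<in> colon D K x" "b \<in> colon D K x" for a b
    using that assms D_closed(7) by (auto simp: colon_def l_distr)
  show "r \<otimes>\<^bsub>R\<^esub> a \<in> colon D K x" if "a \<in> colon D K x" "r \<in> carrier R" for a r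
    using that assms D_closed(6) by (auto simp: colon_def m_assoc)
qed

text \<open>Two ideals have the same radical iff the same primes contain them, and a prime contains a
  finitely generated ideal iff it contains the generators. This removes ideals and radicals from the
  condition.\<close>

lemma rad_colon_coherent_iff:
  "rad_colon_coherent D K \<longleftrightarrow>
    (\<forall>x\<in>carrier K - D. \<exists>S. finite S \<and> S \<subseteq> D \<and> (\<forall>P\<in>Spec R. S \<subseteq> P \<longleftrightarrow> colon D K x \<subseteq> P))"
proof -
  interpret R: cring R by (rule cring_R)
  have Idl: "Idl\<^bsub>R\<^esub> S \<subseteq> P \<longleftrightarrow> S \<subseteq> P" if "S \<subseteq> D" "P \<in> Spec R" for S P
    using R.Idl_subset_ideal[of P S] that by (simp add: Spec_def primeideal.axioms(1))
  have "(\<exists>I. fin_gen_ideal I R \<and> ideal_radical R I = ideal_radical R (colon D K x)) \<longleftrightarrow>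
      (\<exists>S. finite S \<and> S \<subseteq> D \<and> (\<forall>P\<in>Spec R. S \<subseteq> P \<longleftrightarrow> colon D K x \<subseteq> P))"
    if "x \<in> carrier K" for x
  proof -
    have eq: "ideal_radical R (Idl\<^bsub>R\<^esub> S) = ideal_radical R (colon D K x) \<longleftrightarrow>
        (\<forall>P\<in>Spec R. S \<subseteq> P \<longleftrightarrow> colon D K x \<subseteq> P)" if "S \<subseteq> D" for S
      using R.ideal_radical_eq_iff[OF R.genideal_ideal[of S] colon_ideal[OF \<open>x \<in> carrier K\<close>]]
        Idl[OF that] that by simp
    have "(\<exists>I. fin_gen_ideal I R \<and> ideal_radical R I = ideal_radical R (colon D K x)) \<longleftrightarrow>
        (\<exists>S. finite S \<and> S \<subseteq> D \<and> ideal_radical R (Idl\<^bsub>R\<^esub> S) = ideal_radical R (colon D K x))"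
    proof -
      have "fin_gen_ideal I R \<longleftrightarrow> (\<exists>S. finite S \<and> S \<subseteq> D \<and> I = Idl\<^bsub>R\<^esub> S)" for I
        by (simp add: fin_gen_ideal_def)
      then show ?thesis by auto
    qed
    also have "\<dots> \<longleftrightarrow> (\<exists>S. finite S \<and> S \<subseteq> D \<and> (\<forall>P\<in>Spec R. S \<subseteq> P \<longleftrightarrow> colon D K x \<subseteq> P))"
      by (intro ex_cong1 conj_cong refl eq)
    finally show ?thesis .
  qed
  then show ?thesis
    unfolding rad_colon_coherent_def by (intro ball_cong refl) simp
qed

text \<open>The set \<open>(D : x)\<close> consists of the possible denominators of \<open>x\<close>, and \<open>D\<^sub>P\<close> asks for one outside
  \<open>P\<close>. In this form closure properties of \<open>D\<^sub>P\<close> need no computation with fractions.\<close>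

lemma localization_at_iff:
  assumes "P \<in> Spec R"
  shows "x \<in> localization_at D K P \<longleftrightarrow> x \<in> carrier K \<and> \<not> colon D K x \<subseteq> P"
proof
  assume "x \<in> localization_at D K P"
  then obtain a s where as: "a \<in> D" "s \<in> D" "s \<notin> P" "x = a \<otimes> inv s"
    unfolding localization_at_def by blast
  then have s: "s \<noteq> \<zero>" using SpecD(2)[OF assms] by blast
  have "s \<otimes> x = a"
    using as s by (metis D_carrier inv_cancel(1) inv_in_carrier m_lcomm r_one)
  then show "x \<in> carrier K \<and> \<not> colon D K x \<subseteq> P"
    using as s by (auto simp: colon_def)
next
  assume x: "x \<in> carrier K \<and> \<not> colon D K x \<subseteq> P"
  then obtain s where s: "s \<in> D" "s \<otimes> x \<in> D" "s \<notin> P"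
    by (auto simp: colon_def)
  then have "s \<noteq> \<zero>" using SpecD(2)[OF assms] by blast
  then have "x = (s \<otimes> x) \<otimes> inv s"
    using s x by (metis D_carrier inv_cancel(1) inv_in_carrier m_assoc m_comm r_one)
  then show "x \<in> localization_at D K P"
    unfolding localization_at_def using s by blast
qed

text \<open>The zero element is listed separately because the inverse of \<open>\<zero>\<close> is an unspecified element,
  which could happen to lie in \<open>T\<close>.\<close>

definition nonunits where "nonunits T = {d \<in> D. d = \<zero> \<or> inv d \<notin> T}"

lemma inv_in_localization_at_iff:
  assumes P: "P \<in> Spec R" and d: "d \<in> D" "d \<noteq> \<zero>"
  shows "inv d \<in> localization_at D K P \<longleftrightarrow> d \<notin> P"
proof
  assume "inv d \<in> localization_at D K P"
  then obtain t where t: "t \<in> D" "t \<notin> P" "t \<otimes> inv d \<in> D"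
    using localization_at_iff[OF P] by (auto simp: colon_def)
  have "(t \<otimes> inv d) \<otimes> d = t"
    using t(1) d by (simp add: m_assoc)
  then show "d \<notin> P"
    using SpecD(5)[OF P _ t(3), of d] t(2) by metis
next
  assume "d \<notin> P"
  moreover have "d \<in> colon D K (inv d)"
    using d D_closed(3) by (simp add: colon_def)
  ultimately show "inv d \<in> localization_at D K P"
    using localization_at_iff[OF P] d by auto
qed

lemma nonunits_localization_at:
  assumes "P \<in> Spec R"
  shows "nonunits (localization_at D K P) = P"
  using inv_in_localization_at_iff[OF assms] SpecD(1,2)[OF assms] by (auto simp: nonunits_def)

lemma localization_at_in_Over:
  assumes P: "P \<in> Spec R"
  shows "localization_at D K P \<in> Over D K"
proof -
  have mem: "x \<in> localization_at D K P \<longleftrightarrow> x \<in> carrier K \<and> (\<exists>s\<in>D - P. s \<otimes> x \<in> D)" for x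
    using localization_at_iff[OF P] by (auto simp: colon_def)
  have mult: "s \<otimes> t \<in> D - P" if "s \<in> D - P" "t \<in> D - P" for s t
    using that SpecD(6)[OF P] D_closed(6) by blast
  have D: "D \<subseteq> localization_at D K P"
    unfolding mem using SpecD(3)[OF P] D_closed(3) by (auto intro!: bexI[of _ \<one>] simp: mem)
  have "subring (localization_at D K P) K"
  proof (rule subringI)
    show "localization_at D K P \<subseteq> carrier K" using mem by blast
    show "\<one> \<in> localization_at D K P" using D D_closed(3) by blast
    fix x assume "x \<in> localization_at D K P"
    then obtain s where x: "x \<in> carrier K" "s \<in> D - P" "s \<otimes> x \<in> D"
      using mem by blast
    then have "s \<otimes> (\<ominus> x) \<in> D"
      using D_closed(5) by (simp add: r_minus)
    then show "\<ominus> x \<in> localization_at D K P"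
      using mem x by auto
    fix y assume "y \<in> localization_at D K P"
    then obtain t where y: "y \<in> carrier K" "t \<in> D - P" "t \<otimes> y \<in> D"
      using mem by blast
    have st: "s \<in> carrier K" "t \<in> carrier K"
      using x y by auto
    have "(s \<otimes> t) \<otimes> (x \<otimes> y) = (s \<otimes> x) \<otimes> (t \<otimes> y)"
      using x(1) y(1) st by algebra
    then show "x \<otimes> y \<in> localization_at D K P"
      using x y mult[of s t] D_closed(6)[of "s \<otimes> x" "t \<otimes> y"]
      unfolding mem by (intro conjI bexI[of _ "s \<otimes> t"]) auto
    have "(s \<otimes> t) \<otimes> (x \<oplus> y) = t \<otimes> (s \<otimes> x) \<oplus> s \<otimes> (t \<otimes> y)"
      using x(1) y(1) st by algebra
    then show "x \<oplus> y \<in> localization_at D K P"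
      using x y mult[of s t] D_closed(6)[of t "s \<otimes> x"] D_closed(6)[of s "t \<otimes> y"] D_closed(7)
      unfolding mem by (intro conjI bexI[of _ "s \<otimes> t"]) auto
  qed
  then show ?thesis using D by (simp add: Over_def)
qed

lemma Loc_subset_Over: "Loc D K \<subseteq> Over D K"
  using localization_at_in_Over by (auto simp: Loc_def)

text \<open>For every overring \<open>T\<close> the set \<open>nonunits T\<close> contains \<open>\<zero>\<close>, not \<open>\<one>\<close>, and contains a product iff
  it contains a factor. Closure under addition alone can fail, and the hypothesis \<open>add\<close> supplies it
  in contrapositive form.\<close>

lemma nonunits_prime:
  assumes T: "T \<in> Over D K"
    and add: "\<And>a b. \<lbrakk>a \<in> D - {\<zero>}; b \<in> D - {\<zero>}; a \<oplus> b \<noteq> \<zero>; inv (a \<oplus> b) \<in> T\<rbrakk> \<Longrightarrow> inv a \<in> T \<or> inv b \<in> T"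
  shows "nonunits T \<in> Spec R"
proof -
  have DT: "D \<subseteq> T" and sub: "subring T K"
    using T by (auto simp: Over_def)
  note T_closed = subringE[OF sub]
  have mult: "r \<otimes> d \<in> nonunits T" if d: "d \<in> nonunits T" and r: "r \<in> D" for d r
  proof (rule ccontr)
    assume *: "r \<otimes> d \<notin> nonunits T"
    have dD: "d \<in> D" using d by (simp add: nonunits_def)
    then have nz: "r \<otimes> d \<noteq> \<zero>" and inT: "inv (r \<otimes> d) \<in> T"
      using * r D_closed(6) by (auto simp: nonunits_def)
    have nz': "r \<noteq> \<zero>" "d \<noteq> \<zero>" using nz r dD by auto
    have "d \<otimes> (r \<otimes> inv (r \<otimes> d)) = (r \<otimes> d) \<otimes> inv (r \<otimes> d)"
      using nz r dD by (simp add: m_comm[of r d] flip: m_assoc)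
    then have "inv d = r \<otimes> inv (r \<otimes> d)"
      using nz r dD by (intro comm_inv_char) auto
    then have "inv d \<in> T"
      using inT r DT T_closed(6) by auto
    then show False using d nz' by (simp add: nonunits_def)
  qed
  have "ideal (nonunits T) R"
  proof (rule cring.ideal_of_closed[OF cring_R])
    show "nonunits T \<subseteq> carrier R" "\<zero>\<^bsub>R\<^esub> \<in> nonunits T"
      using D_closed(2) by (auto simp: nonunits_def)
    show "a \<oplus>\<^bsub>R\<^esub> b \<in> nonunits T" if "a \<in> nonunits T" "b \<in> nonunits T" for a b
    proof (cases "a = \<zero> \<or> b = \<zero>")
      case True
      then show ?thesis using that by (auto simp: nonunits_def)
    next
      case False
      then show ?thesis using that add[of a b] D_closed(7) by (auto simp: nonunits_def)
    qed
    show "r \<otimes>\<^bsub>R\<^esub> a \<in> nonunits T" if "a \<in> nonunits T" "r \<in> carrier R" for a r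
      using that mult by simp
  qed
  then have "primeideal (nonunits T) R"
  proof (rule primeidealI[OF _ cring_R])
    have "\<one> \<notin> nonunits T" using T_closed(3) by (simp add: nonunits_def)
    then show "carrier R \<noteq> nonunits T" using D_closed(3) by auto
    fix a b assume ab: "a \<in> carrier R" "b \<in> carrier R" "a \<otimes>\<^bsub>R\<^esub> b \<in> nonunits T"
    show "a \<in> nonunits T \<or> b \<in> nonunits T"
    proof (rule ccontr)
      assume "\<not> ?thesis"
      then have nz: "a \<noteq> \<zero>" "b \<noteq> \<zero>" and inv: "inv a \<in> T" "inv b \<in> T"
        using ab by (auto simp: nonunits_def)
      have "inv (a \<otimes> b) = inv a \<otimes> inv b"
        using ab nz by (intro comm_inv_char) (simp_all add: m_assoc m_lcomm[of b "inv a"])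
      moreover have "a \<otimes> b \<noteq> \<zero>" using ab nz integral[of a b] by auto
      ultimately show False
        using ab(3) inv T_closed(6) by (auto simp: nonunits_def)
    qed
  qed
  then show ?thesis by (simp add: Spec_def)
qed

lemma localization_at_nonunits_eq:
  assumes T: "T \<in> Over D K" and P: "nonunits T \<in> Spec R"
    and den: "\<And>x. x \<in> T \<Longrightarrow> \<not> colon D K x \<subseteq> nonunits T"
  shows "localization_at D K (nonunits T) = T"
proof
  have DT: "D \<subseteq> T" and sub: "subring T K"
    using T by (auto simp: Over_def)
  show "localization_at D K (nonunits T) \<subseteq> T"
    using DT subringE(6)[OF sub] by (auto simp: localization_at_def nonunits_def)
  show "T \<subseteq> localization_at D K (nonunits T)"
    using den localization_at_iff[OF P] subringE(1)[OF sub] by blast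
qed

section \<open>Topologies on overrings\<close>

abbreviation B where "B F \<equiv> {T \<in> Over D K. F \<subseteq> T}"

lemma topspace_zariski_Over: "topspace (zariski_Over D K) = Over D K"
  unfolding zariski_Over_def topology_generated_by_topspace by blast

lemma topspace_zariski_Spec: "topspace (zariski_Spec R) = Spec R"
proof -
  have "\<one> \<in> carrier R" using D_closed(3) by simp
  then show ?thesis
    unfolding zariski_Spec_def topology_generated_by_topspace using SpecD(3) by blast
qed

lemma openin_B: "\<lbrakk>finite F; F \<subseteq> carrier K\<rbrakk> \<Longrightarrow> openin (zariski_Over D K) (B F)"
  unfolding zariski_Over_def by (rule topology_generated_by_Basis) blast

lemma openin_zariski_OverD:
  assumes "openin (zariski_Over D K) U" "T \<in> U"
  shows "\<exists>F. finite F \<and> F \<subseteq> carrier K \<and> T \<in> B F \<and> B F \<subseteq> U"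
proof -
  have "generate_topology_on {B F | F. finite F \<and> F \<subseteq> carrier K} U"
    using assms(1) unfolding zariski_Over_def by (rule openin_topology_generated_by)
  then show ?thesis using assms(2)
  proof (induction arbitrary: T)
    case (Int U V)
    then obtain F G where "finite F" "F \<subseteq> carrier K" "T \<in> B F" "B F \<subseteq> U"
      "finite G" "G \<subseteq> carrier K" "T \<in> B G" "B G \<subseteq> V"
      by (meson IntE)
    moreover from this have "B (F \<union> G) \<subseteq> U \<inter> V" "T \<in> B (F \<union> G)" by auto
    ultimately show ?case by (intro exI[of _ "F \<union> G"]) simp
  next
    case (UN \<U>)
    then show ?case by (meson Sup_upper UnionE order_trans)
  next
    case (Basis U)
    then show ?case by blast
  qed simp
qed

lemma generated_overring:
  assumes "F \<subseteq> carrier K"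
  shows "generate_ring K (D \<union> F) \<in> B F"
    and "T \<in> B F \<Longrightarrow> generate_ring K (D \<union> F) \<subseteq> T"
proof -
  have DF: "D \<union> F \<subseteq> carrier K" using assms D_closed(1) by blast
  show "generate_ring K (D \<union> F) \<in> B F"
    using generate_ring_is_subring[OF DF] by (auto simp: Over_def intro: generate_ring.incl)
  show "T \<in> B F \<Longrightarrow> generate_ring K (D \<union> F) \<subseteq> T"
    using generate_ring_min_subring1[OF DF] by (simp add: Over_def)
qed

text \<open>A basic open set has a smallest element, the overring generated by \<open>F\<close>; every open set that
  contains this element contains the whole basic open set.\<close>

lemma compactin_B:
  assumes "F \<subseteq> carrier K"
  shows "compactin (zariski_Over D K) (B F)"
  unfolding compactin_def
proof (intro conjI allI impI)
  let ?T = "generate_ring K (D \<union> F)"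
  show "B F \<subseteq> topspace (zariski_Over D K)"
    using topspace_zariski_Over by blast
  fix \<U> assume \<U>: "(\<forall>U\<in>\<U>. openin (zariski_Over D K) U) \<and> B F \<subseteq> \<Union>\<U>"
  then obtain U where U: "U \<in> \<U>" "?T \<in> U"
    using generated_overring(1)[OF assms] by blast
  then obtain G where "?T \<in> B G" "B G \<subseteq> U"
    using openin_zariski_OverD[OF _ U(2)] \<U> U(1) by (metis (no_types, lifting))
  then have "B F \<subseteq> U"
    using generated_overring(2)[OF assms] by blast
  then show "\<exists>\<F>. finite \<F> \<and> \<F> \<subseteq> \<U> \<and> B F \<subseteq> \<Union>\<F>"
    using U by (intro exI[of _ "{U}"]) auto
qed

lemma finitely_many_generators:
  assumes "F \<subseteq> carrier K" "x \<in> generate_ring K (D \<union> F)"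
  shows "\<exists>F'. finite F' \<and> F' \<subseteq> F \<and> x \<in> generate_ring K (D \<union> F')"
proof -
  have mono: "generate_ring K (D \<union> A) \<subseteq> generate_ring K (D \<union> (A \<union> A'))"
    if "A \<subseteq> F" "A' \<subseteq> F" for A A'
    by (rule mono_generate_ring) (use that assms(1) D_closed(1) in auto)
  have union: "\<exists>F'. finite F' \<and> F' \<subseteq> F \<and> a \<in> generate_ring K (D \<union> F') \<and> b \<in> generate_ring K (D \<union> F')"
    if "finite A" "A \<subseteq> F" "a \<in> generate_ring K (D \<union> A)" "finite A'" "A' \<subseteq> F" "b \<in> generate_ring K (D \<union> A')"
    for a b A A'
    using mono[of A A'] mono[of A' A] that by (intro exI[of _ "A \<union> A'"]) (auto simp: Un_commute)
  from assms(2) show ?thesis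
  proof (induction rule: generate_ring.induct)
    case one
    then show ?case by (intro exI[of _ "{}"]) (simp add: generate_ring.one)
  next
    case (incl h)
    then show ?case
      by (intro exI[of _ "{h} \<inter> F"]) (auto intro: generate_ring.incl)
  next
    case (a_inv h)
    then show ?case by (blast intro: generate_ring.a_inv)
  next
    case (eng_add a b)
    then obtain A A' where "finite A" "A \<subseteq> F" "a \<in> generate_ring K (D \<union> A)"
      "finite A'" "A' \<subseteq> F" "b \<in> generate_ring K (D \<union> A')" by blast
    from union[OF this] show ?case by (blast intro: generate_ring.eng_add)
  next
    case (eng_mult a b)
    then obtain A A' where "finite A" "A \<subseteq> F" "a \<in> generate_ring K (D \<union> A)"
      "finite A'" "A' \<subseteq> F" "b \<in> generate_ring K (D \<union> A')" by blast
    from union[OF this] show ?case by (blast intro: generate_ring.eng_mult)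
  qed
qed

abbreviation Constr where "Constr \<equiv> constructible_topology (zariski_Over D K)"

lemma topspace_Constr: "topspace Constr = Over D K"
proof
  show "topspace Constr \<subseteq> Over D K"
    unfolding constructible_topology_def topology_generated_by_topspace
    using openin_subset[of "zariski_Over D K"] topspace_zariski_Over by auto
  have "B {} \<subseteq> topspace Constr"
    using openin_B[of "{}"] compactin_B[of "{}"]
    unfolding constructible_topology_def topology_generated_by_topspace by blast
  then show "Over D K \<subseteq> topspace Constr" by simp
qed

lemma openin_Constr:
  assumes "x \<in> carrier K"
  shows "openin Constr {T \<in> Over D K. x \<in> T}" "openin Constr {T \<in> Over D K. x \<notin> T}"
proof -
  have "openin (zariski_Over D K) (B {x})" "compactin (zariski_Over D K) (B {x})"
    using openin_B[of "{x}"] compactin_B[of "{x}"] assms by auto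
  then have "openin Constr (B {x})" "openin Constr (topspace (zariski_Over D K) - B {x})"
    unfolding constructible_topology_def by (auto intro!: topology_generated_by_Basis)
  moreover have "topspace (zariski_Over D K) - B {x} = {T \<in> Over D K. x \<notin> T}"
    unfolding topspace_zariski_Over by blast
  ultimately show "openin Constr {T \<in> Over D K. x \<in> T}" "openin Constr {T \<in> Over D K. x \<notin> T}"
    by auto
qed

lemma closedin_Constr:
  assumes "x \<in> carrier K"
  shows "closedin Constr {T \<in> Over D K. x \<in> T}" "closedin Constr {T \<in> Over D K. x \<notin> T}"
proof -
  have "{T \<in> Over D K. x \<in> T} = topspace Constr - {T \<in> Over D K. x \<notin> T}"
    "{T \<in> Over D K. x \<notin> T} = topspace Constr - {T \<in> Over D K. x \<in> T}"
    unfolding topspace_Constr by blast+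
  then show "closedin Constr {T \<in> Over D K. x \<in> T}" "closedin Constr {T \<in> Over D K. x \<notin> T}"
    using closedin_diff[OF closedin_topspace openin_Constr(1)[OF assms]]
      closedin_diff[OF closedin_topspace openin_Constr(2)[OF assms]] by (simp_all only:)
qed

text \<open>Compactness of the constructible topology is proved through this simpler family of generators,
  to which Alexander's theorem applies directly.\<close>

definition clopen_subbase where
  "clopen_subbase = {{T \<in> Over D K. x \<in> T} | x. x \<in> carrier K} \<union> {{T \<in> Over D K. x \<notin> T} | x. x \<in> carrier K}"

lemma Union_clopen_subbase: "\<Union>clopen_subbase = Over D K"
  unfolding clopen_subbase_def using one_closed by blast

text \<open>Given a cover, let \<open>F\<close> be the set of all \<open>x\<close> for which the condition \<open>x \<notin> T\<close> belongs to it. The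
  overring generated by \<open>F\<close> violates all these conditions, so it is covered by a condition \<open>a \<in> T\<close>.
  Only finitely many elements of \<open>F\<close> are needed to generate \<open>a\<close>, and an overring that contains them
  contains \<open>a\<close>.\<close>

lemma compact_space_clopen_subbase: "compact_space (topology_generated_by clopen_subbase)"
proof (rule compact_space_topology_generated_by, unfold Union_clopen_subbase)
  fix \<C> assume \<C>: "\<C> \<subseteq> clopen_subbase" "\<Union>\<C> = Over D K"
  define F where "F = {x \<in> carrier K. {T \<in> Over D K. x \<notin> T} \<in> \<C>}"
  have F: "F \<subseteq> carrier K" by (auto simp: F_def)
  let ?T = "generate_ring K (D \<union> F)"
  have T: "?T \<in> Over D K" "F \<subseteq> ?T"
    using generated_overring(1)[OF F] by auto
  then obtain U where U: "U \<in> \<C>" "?T \<in> U" using \<C>(2) by blast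
  moreover have "U \<noteq> {T \<in> Over D K. x \<notin> T}" if "x \<in> carrier K" for x
    using U T that by (auto simp: F_def)
  ultimately obtain a where a: "a \<in> carrier K" "U = {T \<in> Over D K. a \<in> T}"
    using \<C>(1) unfolding clopen_subbase_def by blast
  then have "a \<in> ?T" using U by blast
  then obtain F' where F': "finite F'" "F' \<subseteq> F" "a \<in> generate_ring K (D \<union> F')"
    using finitely_many_generators[OF F] by blast
  define \<F> where "\<F> = insert U ((\<lambda>x. {T \<in> Over D K. x \<notin> T}) ` F')"
  have "finite \<F>" "\<F> \<subseteq> \<C>"
    using F' U by (auto simp: \<F>_def F_def)
  moreover have "Over D K \<subseteq> \<Union>\<F>"
  proof
    fix T assume T: "T \<in> Over D K"
    show "T \<in> \<Union>\<F>"
    proof (cases "F' \<subseteq> T")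
      case True
      then have "generate_ring K (D \<union> F') \<subseteq> T"
        using T F' F by (intro generated_overring(2)) auto
      then show ?thesis using F'(3) a(2) T by (auto simp: \<F>_def)
    next
      case False
      then show ?thesis using T by (auto simp: \<F>_def)
    qed
  qed
  moreover from \<open>\<F> \<subseteq> \<C>\<close> have "\<Union>\<F> \<subseteq> Over D K"
    using Union_mono[of \<F> \<C>] \<C>(2) by simp
  ultimately show "\<exists>\<F>. finite \<F> \<and> \<F> \<subseteq> \<C> \<and> \<Union>\<F> = Over D K"
    by (intro exI[of _ \<F>]) simp
qed

text \<open>A compact open set of the Zariski topology is a finite union of basic open sets, so it and its
  complement are open in the topology generated by \<open>clopen_subbase\<close>. The constructible topology is
  therefore coarser than a compact one.\<close>

lemma compact_space_Constr: "compact_space Constr"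
proof (rule compact_space_coarser[OF compact_space_clopen_subbase])
  let ?\<tau> = "topology_generated_by clopen_subbase"
  have top: "topspace ?\<tau> = Over D K"
    by (simp add: Union_clopen_subbase)
  show "topspace Constr = topspace ?\<tau>"
    using top topspace_Constr by simp
  have sub: "openin ?\<tau> {T \<in> Over D K. x \<in> T}" "openin ?\<tau> {T \<in> Over D K. x \<notin> T}"
    if "x \<in> carrier K" for x
    using that by (auto intro!: topology_generated_by_Basis simp: clopen_subbase_def)
  have openB: "openin ?\<tau> (B F)" and openB': "openin ?\<tau> (Over D K - B F)"
    if "finite F" "F \<subseteq> carrier K" for F
  proof -
    show "openin ?\<tau> (B F)"
      using that
    proof (induction F)
      case empty
      then show ?case using openin_topspace[of ?\<tau>] top by simp
    next
      case (insert x F)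
      have "B (insert x F) = {T \<in> Over D K. x \<in> T} \<inter> B F" by blast
      then show ?case using insert sub by (simp add: openin_Int)
    qed
    have "Over D K - B F = (\<Union>x\<in>F. {T \<in> Over D K. x \<notin> T})" by blast
    moreover have "openin ?\<tau> (\<Union>x\<in>F. {T \<in> Over D K. x \<notin> T})"
      by (rule openin_Union) (use sub(2) that(2) in blast)
    ultimately show "openin ?\<tau> (Over D K - B F)" by simp
  qed
  have gen: "openin ?\<tau> U" "openin ?\<tau> (Over D K - U)"
    if U: "openin (zariski_Over D K) U" "compactin (zariski_Over D K) U" for U
  proof -
    define \<U> where "\<U> = {B F | F. finite F \<and> F \<subseteq> carrier K \<and> B F \<subseteq> U}"
    have "\<And>V. V \<in> \<U> \<Longrightarrow> openin (zariski_Over D K) V"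
      using openin_B by (auto simp: \<U>_def)
    moreover have "U \<subseteq> \<Union>\<U>"
    proof
      fix T assume "T \<in> U"
      then obtain F where "finite F" "F \<subseteq> carrier K" "T \<in> B F" "B F \<subseteq> U"
        by (elim openin_zariski_OverD[OF U(1), THEN exE] conjE) (rule that)
      then show "T \<in> \<Union>\<U>"
        by (intro UnionI[of "B F"]) (auto simp: \<U>_def)
    qed
    ultimately obtain \<F> where \<F>: "finite \<F>" "\<F> \<subseteq> \<U>" "U \<subseteq> \<Union>\<F>"
      using U(2) unfolding compactin_def by meson
    then have eq: "U = \<Union>\<F>" unfolding \<U>_def by blast
    show "openin ?\<tau> U"
      unfolding eq using \<F>(2) openB by (intro openin_Union) (auto simp: \<U>_def)
    have "closedin ?\<tau> V" if "V \<in> \<F>" for V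
      using that \<F>(2) openB' top unfolding \<U>_def closedin_def by auto
    then have "closedin ?\<tau> U"
      unfolding eq using \<F>(1) by (intro closedin_Union) auto
    then show "openin ?\<tau> (Over D K - U)"
      using top by (metis closedin_def)
  qed
  have "openin ?\<tau> U" if "generate_topology_on ({U. openin (zariski_Over D K) U \<and> compactin (zariski_Over D K) U} \<union>
      {topspace (zariski_Over D K) - U | U. openin (zariski_Over D K) U \<and> compactin (zariski_Over D K) U}) U" for U
    using that
  proof induction
    case (Basis U)
    then show ?case using gen topspace_zariski_Over by auto
  qed auto
  then show "openin ?\<tau> U" if "openin Constr U" for U
    using that unfolding constructible_topology_def openin_topology_generated_by_iff by blast
qed

section \<open>The space of localizations is the spectrum\<close>

lemma openin_zariski_Spec_not_subset:
  assumes "A \<subseteq> D"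
  shows "openin (zariski_Spec R) {P \<in> Spec R. \<not> A \<subseteq> P}"
proof -
  have "openin (zariski_Spec R) {P \<in> Spec R. f \<notin> P}" if "f \<in> A" for f
    unfolding zariski_Spec_def by (rule topology_generated_by_Basis) (use that assms in auto)
  moreover have "{P \<in> Spec R. \<not> A \<subseteq> P} = (\<Union>f\<in>A. {P \<in> Spec R. f \<notin> P})" by blast
  ultimately show ?thesis by auto
qed

lemma continuous_localization_at:
  "continuous_map (zariski_Spec R) (zariski_Over D K) (localization_at D K)"
  unfolding zariski_Over_def
proof (rule continuous_on_generated_topo)
  fix U assume "U \<in> {B F | F. finite F \<and> F \<subseteq> carrier K}"
  then obtain F where F: "finite F" "F \<subseteq> carrier K" "U = B F" by blast
  have "localization_at D K -` B F \<inter> topspace (zariski_Spec R) =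
      {P \<in> topspace (zariski_Spec R). \<forall>x\<in>F. \<not> colon D K x \<subseteq> P}"
    unfolding topspace_zariski_Spec
    using localization_at_iff localization_at_in_Over F(2) by (auto simp: subset_iff)
  also have "\<dots> = (\<Inter>x\<in>F. {P \<in> Spec R. \<not> colon D K x \<subseteq> P}) \<inter> topspace (zariski_Spec R)"
    unfolding topspace_zariski_Spec by blast
  also have "openin (zariski_Spec R) \<dots>"
    by (intro openin_INT[OF F(1)] openin_zariski_Spec_not_subset) (auto simp: colon_def)
  finally show "openin (zariski_Spec R) (localization_at D K -` U \<inter> topspace (zariski_Spec R))"
    using F(3) by simp
next
  have "\<Union>{B F | F. finite F \<and> F \<subseteq> carrier K} = Over D K" by blast
  then show "localization_at D K ` topspace (zariski_Spec R) \<subseteq> \<Union>{B F | F. finite F \<and> F \<subseteq> carrier K}"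
    using localization_at_in_Over topspace_zariski_Spec by auto
qed

lemma Loc_homeomorphic_Spec:
  "subtopology (zariski_Over D K) (Loc D K) homeomorphic_space zariski_Spec R"
proof -
  let ?L = "subtopology (zariski_Over D K) (Loc D K)"
  have top: "topspace ?L = Loc D K"
    using Loc_subset_Over topspace_zariski_Over by auto
  have "continuous_map ?L (zariski_Spec R) nonunits"
    unfolding zariski_Spec_def
  proof (rule continuous_on_generated_topo)
    fix U assume "U \<in> {{P \<in> Spec R. f \<notin> P} | f. f \<in> carrier R}"
    then obtain f where f: "f \<in> D" "U = {P \<in> Spec R. f \<notin> P}" by auto
    show "openin ?L (nonunits -` U \<inter> topspace ?L)"
    proof (cases "f = \<zero>")
      case True
      then have "nonunits -` U = {}"
        using f SpecD(2) by blast
      then show ?thesis by simp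
    next
      case False
      have "nonunits -` U \<inter> topspace ?L = B {inv f} \<inter> Loc D K"
        unfolding top f(2) using f(1) False Loc_subset_Over
        by (auto simp: Loc_def nonunits_localization_at inv_in_localization_at_iff)
      then show ?thesis
        using openin_B[of "{inv f}"] f(1) False by (auto simp: openin_subtopology)
    qed
  next
    have "nonunits ` topspace ?L = Spec R"
      unfolding top by (force simp: Loc_def nonunits_localization_at)
    then show "nonunits ` topspace ?L \<subseteq> \<Union>{{P \<in> Spec R. f \<notin> P} | f. f \<in> carrier R}"
      using topspace_zariski_Spec unfolding zariski_Spec_def topology_generated_by_topspace by blast
  qed
  moreover have "continuous_map (zariski_Spec R) ?L (localization_at D K)"
    using continuous_localization_at
    by (auto simp: continuous_map_in_subtopology topspace_zariski_Spec Loc_def)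
  ultimately have "homeomorphic_maps ?L (zariski_Spec R) nonunits (localization_at D K)"
    unfolding homeomorphic_maps_def top topspace_zariski_Spec
    by (auto simp: Loc_def nonunits_localization_at)
  then show ?thesis unfolding homeomorphic_space_def by blast
qed

section \<open>Proconstructibility\<close>

text \<open>The set \<open>S\<close> comes from a finite subcover of the localizations that contain \<open>x\<close>. A prime \<open>P\<close> that
  contains \<open>S\<close> inverts none of its elements, so \<open>D\<^sub>P\<close> is not covered and cannot contain \<open>x\<close>.\<close>

lemma proconstructible_imp_rad_colon_coherent:
  assumes "proconstructible (zariski_Over D K) (Loc D K)"
  shows "rad_colon_coherent D K"
  unfolding rad_colon_coherent_iff
proof
  fix x assume "x \<in> carrier K - D"
  then have x: "x \<in> carrier K" by blast
  let ?L = "Loc D K \<inter> {T \<in> Over D K. x \<in> T}"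
  let ?U = "\<lambda>f. {T \<in> Over D K. inv f \<in> T}"
  let ?A = "colon D K x - {\<zero>}"
  have "closedin Constr ?L"
    using assms closedin_Constr(1)[OF x] by (auto simp: proconstructible_def)
  then have "compactin Constr ?L"
    by (rule closedin_compact_space[OF compact_space_Constr])
  moreover have "\<forall>U\<in>?U ` ?A. openin Constr U"
    by (auto intro!: openin_Constr inv_in_carrier simp: colon_def)
  moreover have "?L \<subseteq> \<Union>(?U ` ?A)"
  proof
    fix T assume T: "T \<in> ?L"
    then obtain P where P: "P \<in> Spec R" "T = localization_at D K P" by (auto simp: Loc_def)
    then obtain f where f: "f \<in> colon D K x" "f \<notin> P"
      using T localization_at_iff by blast
    then have "f \<in> D" "f \<noteq> \<zero>"
      using SpecD(2)[OF P(1)] by (auto simp: colon_def)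
    then show "T \<in> \<Union>(?U ` ?A)"
      using f T P inv_in_localization_at_iff by auto
  qed
  ultimately obtain \<F> where \<F>: "finite \<F>" "\<F> \<subseteq> ?U ` ?A" "?L \<subseteq> \<Union>\<F>"
    unfolding compactin_def by meson
  obtain S where S: "finite S" "S \<subseteq> ?A" "?L \<subseteq> \<Union>(?U ` S)"
    using finite_subset_image[OF \<F>(1,2)] \<F>(3) by fast
  have "S \<subseteq> P \<longleftrightarrow> colon D K x \<subseteq> P" if P: "P \<in> Spec R" for P
  proof
    assume SP: "S \<subseteq> P"
    show "colon D K x \<subseteq> P"
    proof (rule ccontr)
      assume "\<not> colon D K x \<subseteq> P"
      then have "localization_at D K P \<in> ?L"
        using x localization_at_iff[OF P] localization_at_in_Over[OF P] P by (auto simp: Loc_def)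
      then obtain f where f: "f \<in> S" "inv f \<in> localization_at D K P"
        using S(3) by blast
      then have "f \<in> D" "f \<noteq> \<zero>"
        using S(2) by (auto simp: colon_def)
      then show False
        using f SP inv_in_localization_at_iff[OF P] by blast
    qed
  qed (use S in blast)
  then show "\<exists>S. finite S \<and> S \<subseteq> D \<and> (\<forall>P\<in>Spec R. S \<subseteq> P \<longleftrightarrow> colon D K x \<subseteq> P)"
    using S by (intro exI[of _ S]) (auto simp: colon_def)
qed

text \<open>The first condition makes \<open>nonunits T\<close> a prime. Given that, it contains \<open>S x\<close> iff it contains
  \<open>(D : x)\<close>, so the second condition provides every element \<open>x\<close> of \<open>T\<close> outside \<open>D\<close> with a
  denominator outside \<open>nonunits T\<close>; for \<open>x\<close> in \<open>D\<close> the denominator \<open>\<one>\<close> serves.\<close>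

lemma Loc_eq_of_finite_denominators:
  assumes S: "\<And>x. x \<in> carrier K - D \<Longrightarrow> S x \<subseteq> D"
    and same: "\<And>x P. \<lbrakk>x \<in> carrier K - D; P \<in> Spec R\<rbrakk> \<Longrightarrow> S x \<subseteq> P \<longleftrightarrow> colon D K x \<subseteq> P"
  shows "Loc D K = {T \<in> Over D K.
      (\<forall>a\<in>D - {\<zero>}. \<forall>b\<in>D - {\<zero>}. a \<oplus> b \<noteq> \<zero> \<longrightarrow> inv (a \<oplus> b) \<in> T \<longrightarrow> inv a \<in> T \<or> inv b \<in> T) \<and>
      (\<forall>x\<in>carrier K - D. x \<in> T \<longrightarrow> (\<exists>s\<in>S x - {\<zero>}. inv s \<in> T))}" (is "_ = ?R")
proof
  show "Loc D K \<subseteq> ?R"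
  proof
    fix T assume "T \<in> Loc D K"
    then obtain P where P: "P \<in> Spec R" and T: "T = localization_at D K P" by (auto simp: Loc_def)
    have "inv a \<in> T \<or> inv b \<in> T"
      if "a \<in> D - {\<zero>}" "b \<in> D - {\<zero>}" "a \<oplus> b \<noteq> \<zero>" "inv (a \<oplus> b) \<in> T" for a b
      using that SpecD(4)[OF P] inv_in_localization_at_iff[OF P] D_closed(7) unfolding T by auto
    moreover have "\<exists>s\<in>S x - {\<zero>}. inv s \<in> T" if x: "x \<in> carrier K - D" "x \<in> T" for x
    proof -
      have "\<not> S x \<subseteq> P"
        using same[OF x(1) P] x localization_at_iff[OF P] T by blast
      then obtain s where s: "s \<in> S x" "s \<notin> P" by blast
      then have "s \<in> D" "s \<noteq> \<zero>" using S x(1) SpecD(2)[OF P] by auto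
      then show ?thesis using s inv_in_localization_at_iff[OF P] T by blast
    qed
    ultimately show "T \<in> ?R"
      using localization_at_in_Over[OF P] T by blast
  qed
  show "?R \<subseteq> Loc D K"
  proof
    fix T assume T: "T \<in> ?R"
    then have Over: "T \<in> Over D K" by blast
    have P: "nonunits T \<in> Spec R"
      by (rule nonunits_prime[OF Over]) (use T in blast)
    have "\<not> colon D K x \<subseteq> nonunits T" if x: "x \<in> T" for x
    proof (cases "x \<in> D")
      case True
      then have "\<one> \<in> colon D K x" using D_closed(3) by (simp add: colon_def)
      then show ?thesis using SpecD(3)[OF P] by blast
    next
      case False
      then have xK: "x \<in> carrier K - D"
        using x Over subringE(1) by (auto simp: Over_def)
      then obtain s where "s \<in> S x" "s \<noteq> \<zero>" "inv s \<in> T"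
        using T x by blast
      then have "\<not> S x \<subseteq> nonunits T" by (auto simp: nonunits_def)
      then show ?thesis using same[OF xK P] by blast
    qed
    then have "localization_at D K (nonunits T) = T"
      by (rule localization_at_nonunits_eq[OF Over P])
    then show "T \<in> Loc D K"
      using P unfolding Loc_def by blast
  qed
qed

text \<open>The sets \<open>X a b\<close> and \<open>Y x\<close> below are finite unions of clopen sets, and the localizations are their
  intersection.\<close>

lemma rad_colon_coherent_imp_proconstructible:
  assumes "rad_colon_coherent D K"
  shows "proconstructible (zariski_Over D K) (Loc D K)"
proof -
  obtain S where fin: "\<And>x. x \<in> carrier K - D \<Longrightarrow> finite (S x)"
    and SD: "\<And>x. x \<in> carrier K - D \<Longrightarrow> S x \<subseteq> D"
    and same: "\<And>x P. \<lbrakk>x \<in> carrier K - D; P \<in> Spec R\<rbrakk> \<Longrightarrow> S x \<subseteq> P \<longleftrightarrow> colon D K x \<subseteq> P"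
    using assms unfolding rad_colon_coherent_iff by metis
  define X where "X a b = {T \<in> Over D K. inv (a \<oplus> b) \<notin> T} \<union> {T \<in> Over D K. inv a \<in> T} \<union> {T \<in> Over D K. inv b \<in> T}" for a b
  define Y where "Y x = {T \<in> Over D K. x \<notin> T} \<union> (\<Union>s\<in>S x - {\<zero>}. {T \<in> Over D K. inv s \<in> T})" for x
  \<comment> \<open>The whole space is added so that the family is nonempty and its intersection consists of overrings.\<close>
  define \<X> where "\<X> = insert (Over D K)
    ((\<lambda>(a, b). X a b) ` {(a, b). a \<in> D - {\<zero>} \<and> b \<in> D - {\<zero>} \<and> a \<oplus> b \<noteq> \<zero>} \<union> Y ` (carrier K - D))"
  have "closedin Constr (X a b)" if "a \<in> D - {\<zero>}" "b \<in> D - {\<zero>}" "a \<oplus> b \<noteq> \<zero>" for a b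
    unfolding X_def using that by (intro closedin_Un closedin_Constr) auto
  moreover have "closedin Constr (Y x)" if "x \<in> carrier K - D" for x
    unfolding Y_def using that fin[OF that] SD[OF that]
    by (intro closedin_Un closedin_Constr closedin_Union) (auto intro!: closedin_Constr inv_in_carrier)
  moreover have "closedin Constr (Over D K)"
    using closedin_topspace[of Constr] topspace_Constr by simp
  ultimately have "closedin Constr (\<Inter>\<X>)"
    by (intro closedin_Inter) (auto simp: \<X>_def)
  moreover have "Loc D K = \<Inter>\<X>"
  proof -
    have "\<Inter>\<X> = {T \<in> Over D K. (\<forall>a\<in>D - {\<zero>}. \<forall>b\<in>D - {\<zero>}. a \<oplus> b \<noteq> \<zero> \<longrightarrow> T \<in> X a b) \<and> (\<forall>x\<in>carrier K - D. T \<in> Y x)}"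
      by (auto simp: \<X>_def)
    also have "\<dots> = Loc D K"
    proof -
      have "Loc D K = {T \<in> Over D K.
          (\<forall>a\<in>D - {\<zero>}. \<forall>b\<in>D - {\<zero>}. a \<oplus> b \<noteq> \<zero> \<longrightarrow> inv (a \<oplus> b) \<in> T \<longrightarrow> inv a \<in> T \<or> inv b \<in> T) \<and>
          (\<forall>x\<in>carrier K - D. x \<in> T \<longrightarrow> (\<exists>s\<in>S x - {\<zero>}. inv s \<in> T))}"
        by (rule Loc_eq_of_finite_denominators) (fact SD, fact same)
      then show ?thesis by (auto simp: X_def Y_def)
    qed
    finally show ?thesis by simp
  qed
  ultimately show ?thesis by (simp add: proconstructible_def)
qed

end

theorem theorem3p2:
  fixes K :: "'a ring" and D :: "'a set"
  assumes "quotient_field D K"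
  shows "spectral_space TYPE('a) (subtopology (zariski_Over D K) (Loc D K)) \<and>
    (proconstructible (zariski_Over D K) (Loc D K) \<longleftrightarrow> rad_colon_coherent D K)"
proof -
  interpret subring_of_field K D
    using assms by (simp add: quotient_field_def subring_of_field_def subring_of_field_axioms_def)
  show ?thesis
    using Loc_homeomorphic_Spec cring_R proconstructible_imp_rad_colon_coherent
      rad_colon_coherent_imp_proconstructible
    unfolding spectral_space_def by blast
qed

end
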